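(* Let $A\in\mathbb{Z}^{m\times s}$ be a matrix of rank $s$ with elementary divisors $1=\alpha_1=\dots=\alpha_t<\alpha_{t+1}<\dots<\alpha_s$. Let $S\in\mathbb{Z}^{m\times m}$ and $T\in\mathbb{Z}^{s\times s}$ be weakly unimodular matrices such that $S^{-1}AT^{-1}$ is the Smith normal form of $A$, and for $1\le j\le s-t$ set $\mathbf{v}_{A,j}=T^{-1}\frac{1}{\alpha_{t+j}}\mathbf{e}_{t+j}\in\mathbb{Q}^s$. Then $\mathcal{P}_A$ is reflexive if and only if $\mathbf{v}_{A,j}^\top\mathbf{b}\in\mathbb{Z}$ for all $\mathbf{b}\in\{-1,1\}^s$ and all $1\le j\le s-t$.
   Context: $\mathcal{P}_A=\operatorname{conv}$ of the columns of $A$ and $-A$. A matrix is weakly unimodular if it is an integer matrix with determinant $\pm1$. The Smith normal form of $A$ of rank $r$ is the $m\times s$ matrix $D=S^{-1}AT^{-1}$ whose only nonzero entries are the diagonal entries $D_{ii}=\alpha_i$, $1\le i\le r$, with $\alpha_i\mid\alpha_{i+1}$; these $\alpha_i$ are the elementary divisors. $\mathbf{e}_i$ denotes a standard unit vector. A centrally symmetric lattice polytope $P\subseteq\mathbb{R}^m$ is reflexive if for every facet $\mathcal{F}$ of $P$ there is $\mathbf{w}\in\mathbb{Z}^m$ with $P\subseteq\{\mathbf{x}:\mathbf{w}^\top\mathbf{x}\le1\}$ and $\mathcal{F}=P\cap\{\mathbf{x}:\mathbf{w}^\top\mathbf{x}=1\}$. *)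

theory Defs
  imports "HOL-Analysis.Analysis"
begin

(* A linearly ordered finite index type with n elements stands for {1,...,n}:
   index_pos is the order isomorphism onto {1..n}. *)
definition index_pos :: "'n::{finite,linorder} \<Rightarrow> nat" where
  "index_pos i = card {j. j \<le> i}"

(* The standard unit vector e_k with k counted from 1. *)
definition unit_vec :: "nat \<Rightarrow> 'a::zero_neq_one ^ 'n::{finite,linorder}" where
  "unit_vec k = (\<chi> i. if index_pos i = k then 1 else 0)"

definition weakly_unimodular :: "int ^ 'n ^ 'n \<Rightarrow> bool" where
  "weakly_unimodular U \<longleftrightarrow> det U = 1 \<or> det U = - 1"

(* D is the Smith normal form of A, with the elementary divisors alpha 1, ..., alpha r
   on the diagonal; only these values of alpha are constrained.  Elementary divisors are
   normalised to be positive. *)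
definition smith_normal_form ::
  "int ^ 's::{finite,linorder} ^ 'm::{finite,linorder} \<Rightarrow>
   int ^ 's::{finite,linorder} ^ 'm::{finite,linorder} \<Rightarrow> (nat \<Rightarrow> int) \<Rightarrow> bool" where
  "smith_normal_form A D \<alpha> \<longleftrightarrow>
     (let r = rank (map_matrix rat_of_int A) in
       (\<exists>S T. weakly_unimodular S \<and> weakly_unimodular T \<and>
              D = matrix_inv S ** A ** matrix_inv T) \<and>
       (\<forall>i j. D $ i $ j =
          (if index_pos i = index_pos j \<and> index_pos i \<le> r then \<alpha> (index_pos i) else 0)) \<and>
       (\<forall>i\<in>{1..r}. \<alpha> i > 0) \<and>
       (\<forall>i. 1 \<le> i \<and> i < r \<longrightarrow> \<alpha> i dvd \<alpha> (i + 1)))"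

definition sym_polytope :: "int ^ 's ^ 'm \<Rightarrow> (real ^ 'm) set" where
  "sym_polytope A =
     convex hull (columns (map_matrix real_of_int A) \<union> columns (map_matrix real_of_int (- A)))"

definition integral_vec :: "real ^ 'm \<Rightarrow> bool" where
  "integral_vec w \<longleftrightarrow> (\<forall>i. w $ i \<in> \<int>)"

definition lattice_polytope :: "(real ^ 'm) set \<Rightarrow> bool" where
  "lattice_polytope P \<longleftrightarrow> (\<exists>V. finite V \<and> (\<forall>v\<in>V. integral_vec v) \<and> P = convex hull V)"

definition centrally_symmetric :: "(real ^ 'm) set \<Rightarrow> bool" where
  "centrally_symmetric P \<longleftrightarrow> uminus ` P = P"

(* P need not be full-dimensional: facets are taken relative to the affine hull of P,
   so the functional w of a facet need not be unique. *)
definition reflexive_polytope :: "(real ^ 'm) set \<Rightarrow> bool" where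
  "reflexive_polytope P \<longleftrightarrow>
     lattice_polytope P \<and> centrally_symmetric P \<and>
     (\<forall>F. F facet_of P \<longrightarrow>
        (\<exists>w. integral_vec w \<and> P \<subseteq> {x. w \<bullet> x \<le> 1} \<and> F = P \<inter> {x. w \<bullet> x = 1}))"

(* The vector v_{A,j}; t is the number of elementary divisors equal to 1. *)
definition divisor_vec ::
  "int ^ 's::{finite,linorder} ^ 's::{finite,linorder} \<Rightarrow> (nat \<Rightarrow> int) \<Rightarrow> nat \<Rightarrow> nat \<Rightarrow>
   rat ^ 's::{finite,linorder}" where
  "divisor_vec T \<alpha> t j =
     map_matrix rat_of_int (matrix_inv T) *v ((1 / rat_of_int (\<alpha> (t + j))) *s unit_vec (t + j))"

end

theory Submission
  imports Defs
begin

text \<open>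
  The polytope is the image of the cross polytope, so its facets are the sets on which a functional
  takes the values \<open>b\<^sub>i = \<plusminus>1\<close> on the columns \<open>a\<^sub>i\<close> of \<open>A\<close>. Hence it is reflexive iff
  \<open>A\<^sup>T w = b\<close> has an integral solution \<open>w\<close> for every sign vector \<open>b\<close>. Substituting
  \<open>A = S D T\<close> with \<open>S\<close> and \<open>T\<close> invertible over the integers turns this into divisibility of the
  \<open>k\<close>-th entry of \<open>T\<^sup>-\<^sup>T b\<close> by \<open>\<alpha>\<^sub>k\<close>, which is vacuous when \<open>\<alpha>\<^sub>k = 1\<close>.
\<close>

section \<open>Invertibility of weakly unimodular matrices over the integers\<close>

lemma det_replace_row_by_combination:
  fixes A :: "'a::comm_ring_1 ^ 'n ^ 'n"
  assumes "finite J"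
  shows "det (\<chi> i. if i = k then (\<Sum>j\<in>J. c j *s v j) else row i A) =
    (\<Sum>j\<in>J. c j * det (\<chi> i. if i = k then v j else row i A))"
  using assms
proof (induction J)
  case empty
  show ?case using det_row_0[of k "\<lambda>i. row i A"] by (simp cong: if_cong)
next
  case (insert x J)
  then show ?case
    using det_row_add[of k "\<lambda>_. c x *s v x" "\<lambda>_. \<Sum>j\<in>J. c j *s v j" "\<lambda>i. row i A"]
      det_row_mul[of k "c x" "\<lambda>_. v x" "\<lambda>i. row i A"]
    by (simp cong: if_cong)
qed

text \<open>Over the integers invertibility cannot be taken from the library's results, which need a field.\<close>

lemma exists_adjugate:
  fixes A :: "'a::comm_ring_1 ^ 'n ^ 'n"
  shows "\<exists>B. A ** B = mat (det A)"
proof -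
  \<comment> \<open>\<open>B\<close> is the adjugate: replacing row \<open>k\<close> by the
    \<open>j\<close>-th unit vector gives the cofactor at \<open>(k, j)\<close>.\<close>
  define B :: "'a ^ 'n ^ 'n" where
    "B = (\<chi> j k. det (\<chi> i. if i = k then axis j 1 else row i A))"
  have "(A ** B) $ l $ k = (if l = k then det A else 0)" for l k
  proof -
    have expand: "(\<Sum>j\<in>UNIV. A $ l $ j *s axis j 1) = row l A"
      by (simp add: vec_eq_iff row_def axis_def if_distrib cong: if_cong)
    \<comment> \<open>Linearity in row \<open>k\<close> collapses the sum into the determinant of
      \<open>A\<close> with row \<open>k\<close> replaced by row \<open>l\<close>; for distinct
      \<open>l\<close> and \<open>k\<close> two rows agree.\<close>
    have "(A ** B) $ l $ k = (\<Sum>j\<in>UNIV. A $ l $ j * det (\<chi> i. if i = k then axis j 1 else row i A))"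
      by (simp add: matrix_matrix_mult_def B_def)
    also have "\<dots> = det (\<chi> i. if i = k then row l A else row i A)"
      by (subst det_replace_row_by_combination[symmetric]) (simp_all only: expand finite)
    also have "\<dots> = (if l = k then det A else 0)"
    proof (cases "l = k")
      case True
      then have "(\<chi> i. if i = k then row l A else row i A) = A"
        by (auto simp: vec_eq_iff row_def)
      with True show ?thesis by simp
    next
      case False
      then show ?thesis
        by (subst det_identical_rows[of k l]) (auto simp: row_def vec_eq_iff)
    qed
    finally show ?thesis .
  qed
  then show ?thesis by (intro exI[of _ B]) (simp add: vec_eq_iff mat_def)
qed

text \<open>\<open>matrix_inv\<close> is a choice, so a two-sided inverse has to be exhibited. The
  adjugate gives right inverses of \<open>U\<close> and of its transpose, and associativity
  identifies the resulting right and left inverses of \<open>U\<close>.\<close>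

lemma weakly_unimodular_inverse:
  assumes "weakly_unimodular U"
  shows "U ** matrix_inv U = mat 1 \<and> matrix_inv U ** U = mat 1"
proof -
  have right: "\<exists>B. V ** B = mat 1" if "det V = 1 \<or> det V = - 1" for V :: "int ^ 'a ^ 'a"
  proof -
    from exists_adjugate obtain B where B: "V ** B = mat (det V)" by blast
    \<comment> \<open>The factor \<open>det V\<close> is its own inverse.\<close>
    have "V ** (\<chi> i j. det V * B $ i $ j) = (\<chi> i j. det V * (V ** B) $ i $ j)"
      by (simp add: vec_eq_iff matrix_matrix_mult_def sum_distrib_left algebra_simps)
    also have "\<dots> = mat 1"
      using that by (auto simp: B vec_eq_iff mat_def)
    finally show ?thesis by blast
  qed
  obtain B where B: "U ** B = mat 1"
    using right assms by (auto simp: weakly_unimodular_def)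
  obtain C where "transpose U ** C = mat 1"
    using right[of "transpose U"] assms by (auto simp: weakly_unimodular_def)
  then have C: "transpose C ** U = mat 1"
    by (metis matrix_transpose_mul transpose_mat transpose_transpose)
  have "transpose C = B"
    by (metis B C matrix_mul_assoc matrix_mul_lid matrix_mul_rid)
  with B C have "\<exists>A'. U ** A' = mat 1 \<and> A' ** U = mat 1" by blast
  then show ?thesis
    unfolding matrix_inv_def by (rule someI_ex)
qed

section \<open>Positions in finite linear orders and the bound of the rank by the number of
  rows\<close>

lemma inj_index_pos: "inj (index_pos :: 'n::{finite,linorder} \<Rightarrow> nat)"
proof (rule linorder_inj_onI)
  fix x y :: 'n assume "x < y"
  then have "{j. j \<le> x} \<subseteq> {j. j \<le> y}" "y \<in> {j. j \<le> y}" "y \<notin> {j. j \<le> x}" by auto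
  then have "{j. j \<le> x} \<subset> {j. j \<le> y}" by blast
  then show "index_pos x \<noteq> index_pos y"
    unfolding index_pos_def using psubset_card_mono by (metis finite less_irrefl)
qed auto

lemma bij_betw_index_pos:
  "bij_betw (index_pos :: 'n::{finite,linorder} \<Rightarrow> nat) UNIV {1..CARD('n::{finite,linorder})}"
  unfolding bij_betw_def
proof
  have "range (index_pos :: 'n \<Rightarrow> nat) \<subseteq> {1..CARD('n)}"
    by (auto simp: index_pos_def card_gt_0_iff Suc_le_eq intro!: card_mono)
  moreover have "card (range (index_pos :: 'n \<Rightarrow> nat)) = CARD('n)"
    by (simp add: card_image inj_index_pos)
  ultimately show "range (index_pos :: 'n \<Rightarrow> nat) = {1..CARD('n)}"
    by (intro card_subset_eq) auto
qed (rule inj_index_pos)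

lemma index_pos_bounds:
  fixes i :: "'n::{finite,linorder}"
  shows "1 \<le> index_pos i" "index_pos i \<le> CARD('n)"
  using bij_betw_index_pos[where 'n = 'n] by (auto simp: bij_betw_def)

lemma ex_index_pos:
  assumes "1 \<le> k" "k \<le> CARD('n::{finite,linorder})"
  obtains i :: "'n::{finite,linorder}" where "index_pos i = k"
proof -
  have "k \<in> range (index_pos :: 'n \<Rightarrow> nat)"
    using bij_betw_index_pos[where 'n = 'n] assms by (auto simp: bij_betw_def)
  then show ?thesis using that by blast
qed

lemma rank_le_rows: "rank (A :: 'a::field ^ 'n ^ 'm) \<le> CARD('m)"
proof -
  have "rows A = range (\<lambda>i. row i A)" by (auto simp: rows_def)
  then have "finite (rows A)" "card (rows A) \<le> CARD('m)" by (simp_all add: card_image_le)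
  then show ?thesis
    unfolding row_rank_def_gen using vec.dim_le_card' by (metis le_trans)
qed

section \<open>Integral solvability read off the Smith normal form\<close>

lemma mul_diagonal_solvable_iff:
  fixes D :: "int ^ 's::{finite,linorder} ^ 'm::{finite,linorder}"
  assumes D: "\<And>i j. D $ i $ j = (if index_pos i = index_pos j then \<alpha> (index_pos j) else 0)"
    and "CARD('s) \<le> CARD('m)"
  shows "(\<exists>u. u v* D = y) \<longleftrightarrow> (\<forall>j. \<alpha> (index_pos j) dvd y $ j)"
proof -
  have "\<exists>i :: 'm. index_pos i = index_pos j" for j :: 's
    using index_pos_bounds[of j] ex_index_pos[of "index_pos j"] assms(2) by (metis le_trans)
  \<comment> \<open>\<open>e j\<close> is the only row in which column \<open>j\<close> of
    \<open>D\<close> can be nonzero, so the system decouples into one equation per column.\<close>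
  then obtain e :: "'s \<Rightarrow> 'm" where e: "\<And>j. index_pos (e j) = index_pos j" by metis
  have e_unique: "index_pos i = index_pos j \<longleftrightarrow> i = e j" for i j
    by (metis e inj_index_pos injD)
  have mul: "(u v* D) $ j = u $ e j * \<alpha> (index_pos j)" for u j
    by (simp add: vector_matrix_mult_def D e_unique if_distrib cong: if_cong)
  have inj_e: "inj e"
    by (metis e inj_index_pos injD injI)
  show ?thesis
  proof
    assume "\<exists>u. u v* D = y"
    then show "\<forall>j. \<alpha> (index_pos j) dvd y $ j" using mul by (metis dvd_triv_right)
  next
    assume dvd: "\<forall>j. \<alpha> (index_pos j) dvd y $ j"
    \<comment> \<open>Off the range of \<open>e\<close> the value of \<open>inv e i\<close> is
      arbitrary, but there the rows of \<open>D\<close> vanish.\<close>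
    define u where "u = (\<chi> i. y $ inv e i div \<alpha> (index_pos (inv e i)))"
    have "u v* D = y"
      using dvd by (simp add: vec_eq_iff mul u_def inj_e)
    then show "\<exists>u. u v* D = y" ..
  qed
qed

text \<open>In row-vector form, \<open>u = w v* S\<close> is a bijective substitution on integer
  vectors that turns \<open>A\<close> into the diagonal matrix.\<close>

lemma integer_solution_iff:
  fixes A :: "int ^ 's::{finite,linorder} ^ 'm::{finite,linorder}"
  assumes "weakly_unimodular S" "weakly_unimodular T"
    and "\<And>i j. (matrix_inv S ** A ** matrix_inv T) $ i $ j =
      (if index_pos i = index_pos j then \<alpha> (index_pos j) else 0)"
    and "CARD('s) \<le> CARD('m)"
  shows "(\<exists>w. w v* A = c) \<longleftrightarrow> (\<forall>j. \<alpha> (index_pos j) dvd (c v* matrix_inv T) $ j)"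
proof -
  note inv_S = weakly_unimodular_inverse[OF assms(1)]
  note inv_T = weakly_unimodular_inverse[OF assms(2)]
  let ?D = "matrix_inv S ** A ** matrix_inv T"
  have "(\<exists>w. w v* A = c) \<longleftrightarrow> (\<exists>u. u v* ?D = c v* matrix_inv T)"
  proof
    assume "\<exists>w. w v* A = c"
    then obtain w where w: "w v* A = c" ..
    have "w v* S v* ?D = w v* (S ** matrix_inv S) v* A v* matrix_inv T"
      by (simp only: vector_matrix_mul_assoc matrix_mul_assoc)
    then have "w v* S v* ?D = c v* matrix_inv T"
      by (simp add: inv_S w)
    then show "\<exists>u. u v* ?D = c v* matrix_inv T" by blast
  next
    assume "\<exists>u. u v* ?D = c v* matrix_inv T"
    then obtain u where "u v* ?D = c v* matrix_inv T" ..
    then have "u v* matrix_inv S v* A v* (matrix_inv T ** T) = c v* (matrix_inv T ** T)"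
      by (metis vector_matrix_mul_assoc)
    then have "u v* matrix_inv S v* A = c"
      by (simp add: inv_T)
    then show "\<exists>w. w v* A = c" by blast
  qed
  then show ?thesis
    using mul_diagonal_solvable_iff[of ?D \<alpha>, OF assms(3,4)] by simp
qed

text \<open>\<open>divisor_vec T \<alpha> t j\<close> is the \<open>k\<close>-th column of the
  inverse of \<open>T\<close>, divided by its elementary divisor.\<close>

lemma scalar_product_divisor_vec:
  assumes "index_pos k = t + j"
  shows "scalar_product (divisor_vec T \<alpha> t j) b =
    (b v* map_matrix rat_of_int (matrix_inv T)) $ k / rat_of_int (\<alpha> (t + j))"
proof -
  have "index_pos i = t + j \<longleftrightarrow> i = k" for i :: 'a
    using assms inj_index_pos by (metis injD)
  then show ?thesis
    by (simp add: scalar_product_def divisor_vec_def unit_vec_def matrix_vector_mult_def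
        vector_matrix_mult_def if_distrib sum_divide_distrib mult.commute cong: if_cong)
qed

section \<open>The polytope as the hull of the signed columns\<close>

abbreviation real_column :: "int ^ 's ^ 'm \<Rightarrow> 's \<Rightarrow> real ^ 'm" where
  "real_column A i \<equiv> (\<chi> k. real_of_int (A $ k $ i))"

definition signed_columns :: "int ^ 's ^ 'm \<Rightarrow> (real ^ 'm) set" where
  "signed_columns A = range (real_column A) \<union> uminus ` range (real_column A)"

lemma sym_polytope_eq: "sym_polytope A = convex hull signed_columns A"
proof -
  have "columns (map_matrix real_of_int A) = range (real_column A)"
    by (auto simp: columns_def column_def map_matrix_def)
  moreover have "columns (map_matrix real_of_int (- A)) = uminus ` range (real_column A)"
    by (auto simp: columns_def column_def map_matrix_def image_iff vec_eq_iff)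
  ultimately show ?thesis by (simp add: sym_polytope_def signed_columns_def)
qed

lemma inner_real_column:
  "(\<chi> k. real_of_int (w $ k)) \<bullet> real_column A i = real_of_int ((w v* A) $ i)"
  by (simp add: inner_vec_def vector_matrix_mult_def)

lemma integral_vecE:
  assumes "integral_vec w"
  obtains w' :: "int ^ 'm" where "w = (\<chi> k. real_of_int (w' $ k))"
proof
  show "w = (\<chi> k. real_of_int ((\<chi> k. \<lfloor>w $ k\<rfloor>) $ k))"
    using assms by (auto simp: integral_vec_def vec_eq_iff elim!: Ints_cases)
qed

lemma sym_polytope_lattice: "lattice_polytope (sym_polytope A)"
  unfolding lattice_polytope_def sym_polytope_eq
  by (rule exI[of _ "signed_columns A"]) (auto simp: signed_columns_def integral_vec_def)

lemma uminus_signed_columns: "uminus ` signed_columns A = signed_columns A"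
  by (simp add: signed_columns_def image_Un image_image Un_commute)

lemma sym_polytope_centrally_symmetric: "centrally_symmetric (sym_polytope A)"
  using convex_hull_linear_image[OF linear_uminus, of "signed_columns A"]
  by (simp add: centrally_symmetric_def sym_polytope_eq uminus_signed_columns)

text \<open>The origin is the midpoint of a column and its negative. It shows that a face on which a
  functional equals 1 is proper.\<close>

lemma zero_in_sym_polytope: "0 \<in> sym_polytope A"
proof -
  fix i
  have "real_column A i \<in> convex hull signed_columns A" "- real_column A i \<in> convex hull signed_columns A"
    by (auto simp: signed_columns_def intro!: hull_inc)
  from convexD[OF convex_convex_hull this, of "1/2" "1/2"]
  show ?thesis by (simp add: sym_polytope_eq)
qed

lemma polyhedron_sym_polytope: "polyhedron (sym_polytope A)"
  unfolding sym_polytope_eq by (rule polyhedron_convex_hull) (simp add: signed_columns_def)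

section \<open>Facets and integral functionals with prescribed signs on the columns\<close>

lemma sym_polytope_subset_halfspace:
  assumes "\<And>i. u \<bullet> real_column A i \<in> {- 1, 1}"
  shows "sym_polytope A \<subseteq> {x. u \<bullet> x \<le> 1}"
  unfolding sym_polytope_eq
proof (rule hull_minimal)
  have "u \<bullet> real_column A i \<le> 1" "u \<bullet> (- real_column A i) \<le> 1" for i
    using assms[of i] by auto
  then show "signed_columns A \<subseteq> {x. u \<bullet> x \<le> 1}"
    by (auto simp: signed_columns_def)
qed (rule convex_halfspace_le)

text \<open>
  It is not necessary to know that the face cut out by \<open>u\<close> is a facet: any facet containing it
  has a normal vector that takes the values \<open>b\<^sub>i\<close> on the columns.
\<close>

lemma reflexive_imp_sign_solution:
  fixes A :: "int ^ 's ^ 'm"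
  assumes refl: "reflexive_polytope (sym_polytope A)"
    and signs: "\<And>i. b $ i \<in> {- 1, 1}"
    and u: "\<And>i. u \<bullet> real_column A i = real_of_int (b $ i)"
  shows "\<exists>w. w v* A = b"
proof -
  let ?P = "sym_polytope A" and ?G = "sym_polytope A \<inter> {x. u \<bullet> x = 1}"
  have signs': "real_of_int (b $ i) \<in> {- 1, 1}" for i
    using signs[of i] by auto
  have vertex: "real_of_int (b $ i) *\<^sub>R real_column A i \<in> ?G" for i
  proof
    have "real_of_int (b $ i) *\<^sub>R real_column A i \<in> signed_columns A"
      using signs'[of i] by (auto simp: signed_columns_def)
    then show "real_of_int (b $ i) *\<^sub>R real_column A i \<in> ?P"
      by (simp add: sym_polytope_eq hull_inc)
    show "real_of_int (b $ i) *\<^sub>R real_column A i \<in> {x. u \<bullet> x = 1}"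
      using signs'[of i] u[of i] by auto
  qed
  have "?P \<subseteq> {x. u \<bullet> x \<le> 1}"
    using signs' by (intro sym_polytope_subset_halfspace) (simp only: u)
  then have "?G face_of ?P"
    by (intro face_of_Int_supporting_hyperplane_le) (auto simp: sym_polytope_eq)
  moreover have "?G \<noteq> {}" using vertex by blast
  \<comment> \<open>Missing the origin makes the face proper, so that it lies in a facet.\<close>
  moreover have "0 \<notin> ?G" by simp
  then have "?G \<noteq> ?P" using zero_in_sym_polytope[of A] by metis
  ultimately obtain F where F: "F facet_of ?P" "?G \<subseteq> F"
    using face_of_polyhedron_subset_facet[OF polyhedron_sym_polytope] by metis
  from refl F(1) obtain w where w: "integral_vec w" "F = ?P \<inter> {x. w \<bullet> x = 1}"
    unfolding reflexive_polytope_def by blast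
  from w(1) obtain w' :: "int ^ 'm" where w': "w = (\<chi> k. real_of_int (w' $ k))"
    by (rule integral_vecE)
  have "(w' v* A) $ i = b $ i" for i
  proof -
    \<comment> \<open>The facet contains these signed columns; as each sign is its own inverse,
      \<open>w\<close> takes the value \<open>b $ i\<close> on column \<open>i\<close>.\<close>
    have "w \<bullet> (real_of_int (b $ i) *\<^sub>R real_column A i) = 1"
      using vertex[of i] F(2) w(2) by blast
    then have "real_of_int (b $ i) * real_of_int ((w' v* A) $ i) = 1"
      by (simp only: w' inner_scaleR_right inner_real_column)
    then show ?thesis using signs[of i] by auto
  qed
  then show ?thesis by (auto simp: vec_eq_iff)
qed

text \<open>
  The sign vector \<open>b\<close> is read off the normal \<open>a\<close> of the facet. The facet is contained in the
  proper face cut out by the integral \<open>w\<close>, and equals it by dimension.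
\<close>

lemma facet_of_sym_polytope_integral:
  assumes sol: "\<And>b :: int ^ 's. (\<And>i. b $ i \<in> {- 1, 1}) \<Longrightarrow> \<exists>w. w v* A = b"
    and facet: "F facet_of sym_polytope (A :: int ^ 's ^ 'm)"
  shows "\<exists>w. integral_vec w \<and> sym_polytope A \<subseteq> {x. w \<bullet> x \<le> 1} \<and>
    F = sym_polytope A \<inter> {x. w \<bullet> x = 1}"
proof -
  let ?P = "sym_polytope A" and ?V = "signed_columns A"
  have face: "F face_of ?P" and dim: "aff_dim F = aff_dim ?P - 1"
    using facet by (auto simp: facet_of_def)
  have "F exposed_face_of ?P"
    using face exposed_face_of_polyhedron polyhedron_sym_polytope by blast
  then obtain a c where ac: "?P \<subseteq> {x. a \<bullet> x \<le> c}" "F = ?P \<inter> {x. a \<bullet> x = c}"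
    by (auto simp: exposed_face_of_def)
  \<comment> \<open>If \<open>c = 0\<close>, central symmetry makes \<open>a\<close> vanish on the
    whole polytope, which would then equal its facet.\<close>
  have "c \<noteq> 0"
  proof
    assume "c = 0"
    have "?V \<subseteq> {x. a \<bullet> x = 0}"
    proof
      fix v assume "v \<in> ?V"
      moreover from this have "- v \<in> ?V" by (auto simp: signed_columns_def)
      ultimately have "v \<in> ?P" "- v \<in> ?P" by (auto simp: sym_polytope_eq hull_inc)
      then have "a \<bullet> v \<le> 0" "a \<bullet> (- v) \<le> 0" using ac(1) \<open>c = 0\<close> by blast+
      then show "v \<in> {x. a \<bullet> x = 0}" by simp
    qed
    then have "?P \<subseteq> {x. a \<bullet> x = 0}"
      unfolding sym_polytope_eq by (intro hull_minimal convex_hyperplane)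
    then have "F = ?P" using ac(2) \<open>c = 0\<close> by blast
    then show False using dim by simp
  qed
  \<comment> \<open>The sign is -1 when the negated column lies on \<open>F\<close>. Columns with
    neither sign on \<open>F\<close> get 1 by default.\<close>
  define b :: "int ^ 's" where "b = (\<chi> i. if a \<bullet> real_column A i = - c then - 1 else 1)"
  have "b $ i \<in> {- 1, 1}" for i by (simp add: b_def)
  from sol[OF this] obtain w where w: "w v* A = b" by blast
  define w' where "w' = (\<chi> k. real_of_int (w $ k))"
  have inner_w': "w' \<bullet> real_column A i = real_of_int (b $ i)" for i
    unfolding w'_def inner_real_column w ..
  have bound: "?P \<subseteq> {x. w' \<bullet> x \<le> 1}"
    by (rule sym_polytope_subset_halfspace) (simp add: inner_w' b_def)
  define G where "G = ?P \<inter> {x. w' \<bullet> x = 1}"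
  have convex: "convex ?P" by (simp add: sym_polytope_eq)
  have G: "G face_of ?P"
    unfolding G_def using bound convex by (intro face_of_Int_supporting_hyperplane_le) auto
  have "F \<subseteq> G"
  proof -
    \<comment> \<open>A face of the hull is spanned by generators, so it suffices to check signed
      columns lying in \<open>F\<close>. There \<open>c \<noteq> 0\<close> keeps the values
      \<open>c\<close> and \<open>- c\<close> apart, so the sign in \<open>b\<close> is the right
      one.\<close>
    have "compact ?V"
      by (intro finite_imp_compact) (simp add: signed_columns_def)
    then obtain V' where V': "V' \<subseteq> ?V" "F = convex hull V'"
      using face_of_convex_hull_subset face unfolding sym_polytope_eq by metis
    have "V' \<subseteq> {x. w' \<bullet> x = 1}"
    proof
      fix v assume "v \<in> V'"
      then have "v \<in> F" "v \<in> ?V"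
        using V' by (auto simp: hull_inc)
      then have "a \<bullet> v = c" using ac(2) by blast
      then show "v \<in> {x. w' \<bullet> x = 1}"
        using \<open>c \<noteq> 0\<close> \<open>v \<in> ?V\<close> by (auto simp: signed_columns_def inner_w' b_def)
    qed
    then have "F \<subseteq> {x. w' \<bullet> x = 1}"
      unfolding V'(2) by (intro hull_minimal convex_hyperplane)
    then show ?thesis using ac(2) by (auto simp: G_def)
  qed
  moreover have "0 \<notin> G" by (simp add: G_def)
  then have "G \<noteq> ?P" using zero_in_sym_polytope[of A] by metis
  then have "aff_dim G < aff_dim ?P"
    using face_of_aff_dim_lt[OF convex G] by blast
  moreover have "F face_of G"
    using face \<open>F \<subseteq> G\<close> by (rule face_of_subset) (simp add: G_def)
  \<comment> \<open>Otherwise \<open>aff_dim F < aff_dim G < aff_dim ?P\<close>, too large a gap for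
    a facet.\<close>
  ultimately have "F = G"
    using face_of_aff_dim_lt[of G F] face_of_imp_convex[OF G] dim by force
  then show ?thesis
    using bound by (intro exI[of _ w']) (auto simp: G_def w'_def integral_vec_def)
qed

text \<open>The assumption is full column rank with denominators cleared: dividing \<open>w\<close>
  by \<open>N\<close> yields a real functional with the prescribed signs, which reflexivity makes
  integral.\<close>

lemma reflexive_sym_polytope_iff:
  fixes A :: "int ^ 's ^ 'm"
  assumes "\<And>b :: int ^ 's. \<exists>N > 0. \<exists>w. w v* A = N *s b"
  shows "reflexive_polytope (sym_polytope A) \<longleftrightarrow>
    (\<forall>b. (\<forall>i. b $ i \<in> {- 1, 1}) \<longrightarrow> (\<exists>w. w v* A = b))"
proof (intro iffI allI impI)
  fix b :: "int ^ 's"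
  assume refl: "reflexive_polytope (sym_polytope A)" and signs: "\<forall>i. b $ i \<in> {- 1, 1}"
  from assms[of b] obtain N w where N: "N > 0" and w: "w v* A = N *s b" by blast
  have "((1 / real_of_int N) *\<^sub>R (\<chi> k. real_of_int (w $ k))) \<bullet> real_column A i = real_of_int (b $ i)" for i
    using N by (simp only: inner_scaleR_left inner_real_column w) simp
  then show "\<exists>w. w v* A = b"
    using reflexive_imp_sign_solution[OF refl signs[rule_format]] by metis
next
  assume sol: "\<forall>b. (\<forall>i. b $ i \<in> {- 1, 1}) \<longrightarrow> (\<exists>w. w v* A = b)"
  then show "reflexive_polytope (sym_polytope A)"
    unfolding reflexive_polytope_def
  proof (intro conjI allI impI)
    show "\<exists>w. integral_vec w \<and> sym_polytope A \<subseteq> {x. w \<bullet> x \<le> 1} \<and> F = sym_polytope A \<inter> {x. w \<bullet> x = 1}"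
      if "F facet_of sym_polytope A" for F
      using sol that by (intro facet_of_sym_polytope_integral) simp_all
  qed (rule sym_polytope_lattice sym_polytope_centrally_symmetric)+
qed

section \<open>From integral solvability to integrality of the pairings with
  \<open>divisor_vec\<close>\<close>

theorem theorem6p3:
  fixes A :: "int ^ 's::{finite,linorder} ^ 'm::{finite,linorder}"
    and S :: "int ^ 'm::{finite,linorder} ^ 'm::{finite,linorder}"
    and T :: "int ^ 's::{finite,linorder} ^ 's::{finite,linorder}"
    and \<alpha> :: "nat \<Rightarrow> int"
    and t :: nat
  assumes "rank (map_matrix rat_of_int A) = CARD('s)"
    and "weakly_unimodular S"
    and "weakly_unimodular T"
    and "smith_normal_form A (matrix_inv S ** A ** matrix_inv T) \<alpha>"
    and "t \<le> CARD('s)"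
    and "\<forall>i\<in>{1..t}. \<alpha> i = 1"
    and "\<forall>i\<in>{t+1..CARD('s)}. 1 < \<alpha> i"
    and "\<forall>i. t + 1 \<le> i \<and> i < CARD('s) \<longrightarrow> \<alpha> i < \<alpha> (i + 1)"
  shows "reflexive_polytope (sym_polytope A) \<longleftrightarrow>
    (\<forall>b :: rat ^ 's::{finite,linorder}. (\<forall>i. b $ i \<in> {- 1, 1}) \<longrightarrow>
       (\<forall>j\<in>{1..CARD('s) - t}. scalar_product (divisor_vec T \<alpha> t j) b \<in> \<int>))"
proof -
  have card_le: "CARD('s) \<le> CARD('m)"
    using rank_le_rows[of "map_matrix rat_of_int A"] assms(1) by simp
  \<comment> \<open>Full column rank makes the bound \<open>index_pos i \<le> r\<close> automatic on
    the diagonal.\<close>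
  have D: "(matrix_inv S ** A ** matrix_inv T) $ i $ j =
      (if index_pos i = index_pos j then \<alpha> (index_pos j) else 0)" for i j
    using assms(4) index_pos_bounds(2)[of j] by (auto simp: smith_normal_form_def assms(1) Let_def)
  have pos: "\<alpha> (index_pos j) > 0" for j :: 's
    using assms(4) index_pos_bounds[of j] by (auto simp: smith_normal_form_def assms(1) Let_def)
  note solvable = integer_solution_iff[OF assms(2,3) D card_le]
  have multiple: "\<exists>N > 0. \<exists>w. w v* A = N *s b" for b
  proof -
    \<comment> \<open>Every elementary divisor divides this product, so the divisibility criterion
      holds for \<open>?N *s b\<close>.\<close>
    let ?N = "\<Prod>j\<in>(UNIV :: 's set). \<alpha> (index_pos j)"
    have "?N > 0" using pos by (simp add: prod_pos)
    have "\<alpha> (index_pos j) dvd ((?N *s b) v* matrix_inv T) $ j" for j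
    proof -
      have "((?N *s b) v* matrix_inv T) $ j = ?N * (b v* matrix_inv T) $ j"
        by (simp add: vector_matrix_mult_def sum_distrib_left algebra_simps)
      moreover have "\<alpha> (index_pos j) dvd ?N" by (rule dvd_prodI) simp_all
      ultimately show ?thesis by simp
    qed
    then have "\<exists>w. w v* A = ?N *s b" using solvable by blast
    with \<open>?N > 0\<close> show ?thesis by blast
  qed
  \<comment> \<open>The sign vectors of the claim are rational, those of the solvability criterion
    integral; \<open>rat_vec\<close> matches them.\<close>
  define rat_vec :: "int ^ 's::{finite,linorder} \<Rightarrow> rat ^ 's::{finite,linorder}" where
    "rat_vec b = (\<chi> i. rat_of_int (b $ i))" for b
  have integral_iff: "scalar_product (divisor_vec T \<alpha> t j) (rat_vec b) \<in> \<int> \<longleftrightarrow>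
      \<alpha> (index_pos k) dvd (b v* matrix_inv T) $ k" if "index_pos k = t + j" for b j k
  proof -
    have "(rat_vec b v* map_matrix rat_of_int (matrix_inv T)) $ k = rat_of_int ((b v* matrix_inv T) $ k)"
      by (simp add: vector_matrix_mult_def map_matrix_def rat_vec_def)
    then show ?thesis
      using pos[of k] by (simp add: scalar_product_divisor_vec[OF that] that of_int_div_of_int_in_Ints_iff)
  qed
  have sol_iff: "(\<exists>w. w v* A = b) \<longleftrightarrow>
      (\<forall>j\<in>{1..CARD('s) - t}. scalar_product (divisor_vec T \<alpha> t j) (rat_vec b) \<in> \<int>)" for b
    unfolding solvable
  proof (intro iffI ballI allI)
    fix j assume dvd: "\<forall>k. \<alpha> (index_pos k) dvd (b v* matrix_inv T) $ k" and "j \<in> {1..CARD('s) - t}"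
    then have "1 \<le> t + j" "t + j \<le> CARD('s)" by auto
    then obtain k :: 's where "index_pos k = t + j" by (rule ex_index_pos)
    then show "scalar_product (divisor_vec T \<alpha> t j) (rat_vec b) \<in> \<int>"
      by (subst integral_iff) (use dvd in auto)
  next
    fix k :: 's
    assume int: "\<forall>j\<in>{1..CARD('s) - t}. scalar_product (divisor_vec T \<alpha> t j) (rat_vec b) \<in> \<int>"
    show "\<alpha> (index_pos k) dvd (b v* matrix_inv T) $ k"
    proof (cases "index_pos k \<le> t")
      case True
      then show ?thesis using assms(6) index_pos_bounds(1)[of k] by simp
    next
      case False
      then have "index_pos k - t \<in> {1..CARD('s) - t}" and k: "index_pos k = t + (index_pos k - t)"
        using index_pos_bounds(2)[of k] by auto
      with int have "scalar_product (divisor_vec T \<alpha> t (index_pos k - t)) (rat_vec b) \<in> \<int>"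
        by blast
      then show ?thesis unfolding integral_iff[OF k] .
    qed
  qed
  have sign_lift: "\<exists>b'. b = rat_vec b' \<and> (\<forall>i. b' $ i \<in> {- 1, 1})" if "\<forall>i. b $ i \<in> {- 1, 1}" for b
  proof -
    have "b = rat_vec (\<chi> i. if b $ i = 1 then 1 else - 1)"
      using that by (auto simp: rat_vec_def vec_eq_iff)
    moreover have "\<forall>i. (\<chi> i. if b $ i = 1 then (1 :: int) else - 1) $ i \<in> {- 1, 1}"
      by simp
    ultimately show ?thesis by blast
  qed
  have sign_rat_vec: "\<forall>i. rat_vec b $ i \<in> {- 1, 1}" if "\<forall>i. b $ i \<in> {- 1, 1}" for b
  proof
    show "rat_vec b $ i \<in> {- 1, 1}" for i
      using that[rule_format, of i] by (auto simp: rat_vec_def)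
  qed
  let ?integral = "\<lambda>b. \<forall>j\<in>{1..CARD('s) - t}. scalar_product (divisor_vec T \<alpha> t j) b \<in> \<int>"
  show ?thesis
    unfolding reflexive_sym_polytope_iff[OF multiple] sol_iff
  proof (intro iffI allI impI)
    fix b :: "rat ^ 's::{finite,linorder}"
    assume sol: "\<forall>b. (\<forall>i. b $ i \<in> {- 1, 1}) \<longrightarrow> ?integral (rat_vec b)"
      and signs: "\<forall>i. b $ i \<in> {- 1, 1}"
    obtain b' where b': "b = rat_vec b'" "\<forall>i. b' $ i \<in> {- 1, 1}"
      using sign_lift[OF signs] by (elim exE conjE)
    show "?integral b"
      unfolding b'(1) by (rule sol[THEN spec, THEN mp, OF b'(2)])
  next
    fix b :: "int ^ 's::{finite,linorder}"
    assume int: "\<forall>b. (\<forall>i. b $ i \<in> {- 1, 1}) \<longrightarrow> ?integral b"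
      and signs: "\<forall>i. b $ i \<in> {- 1, 1}"
    show "?integral (rat_vec b)"
      by (rule int[THEN spec, THEN mp, OF sign_rat_vec[OF signs]])
  qed
qed

end
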